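(* Coalescing transactions is unsound (transactional monotonicity fails) in both the transactional Power and the transactional ARMv8 memory models: adding $\mathit{stxn}$ edges can make an inconsistent execution consistent. Specifically, let $X$ be the single-threaded execution with two events $r\in R$, $w\in W$ on one location, $\mathit{po}=\mathit{rmw}=\{(r,w)\}$, $\mathit{rf}=\mathit{co}=\emptyset$, no dependencies or fences and (in ARMv8) no acquire/release events, and $\mathit{stxn}=\{(r,r),(w,w)\}$ (two consecutive singleton transactions); let $Y$ be identical to $X$ except that $\mathit{stxn}=\{r,w\}^2$ (one transaction). Then $X$ is inconsistent and $Y$ is consistent, both in the transactional Power model and in the transactional ARMv8 model.
   Context: **Notation.** For binary relations on a set of events $E$: $r^{-1}$, $r^?$, $r^+$, $r^*$ are inverse, reflexive closure, transitive closure, reflexive-transitive closure; $\neg$ is complement; $r_1;r_2$ is relational composition (left to right); $[s]=\{(x,x)\mid x\in s\}$; $r$ is acyclic iff $r^+$ is irreflexive. $r_{\rm e}=r\setminus(\mathit{po}\cup\mathit{po}^{-1})^*$, $r_{\rm i}=r\cap(\mathit{po}\cup\mathit{po}^{-1})^*$, $r_{\rm loc}=r\cap\mathit{sloc}$. $\mathsf{weaklift}(r,t)=t;(r\setminus t);t$ and $\mathsf{stronglift}(r,t)=t^?;(r\setminus t);t^?$. **Executions.** An execution is a finite set $E$ of events, partitioned into reads $R$, writes $W$, fences $F$, with relations: program order $\mathit{po}$ (per-thread strict total order); dependencies $\mathit{addr},\mathit{ctrl},\mathit{data}\subseteq\mathit{po}$ originating at reads; $\mathit{sloc}$, an equivalence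 on $R\cup W$ (same location); $\mathit{rmw}\subseteq\mathit{po}_{\rm loc}$ from the read to the write of a read-modify-write; $\mathit{rf}$ from writes to reads of the same location, each read having at most one incoming edge; $\mathit{co}$, per location a strict total order on its writes; $\mathit{stxn}$ (same successful transaction), a partial equivalence relation whose classes are contiguous subsets of $\mathit{po}$. $\mathit{fr}=([R];\mathit{sloc};[W])\setminus(\mathit{rf}^{-1};(\mathit{co}^{-1})^* )$, $\mathit{com}=\mathit{rf}\cup\mathit{co}\cup\mathit{fr}$, and $\mathit{tfence}=\mathit{po}\cap((\neg\mathit{stxn};\mathit{stxn})\cup(\mathit{stxn};\neg\mathit{stxn}))$. Fence relations such as $\mathit{sync},\mathit{lwsync},\mathit{isync}$ (Power) and $\mathit{dmb},\mathit{dmbld},\mathit{dmbst}$ (ARMv8) relate events in program order separated by a fence event of that kind. **Transactional Power.** Preserved program order is $\mathit{ppo}=([R];\mathit{ii};[R])\cup([R];\mathit{ic};[W])\subseteq\mathit{po}$, where, with $\mathit{dp}=\mathit{addr}\cup\mathit{data}$, $\mathit{rdw}=\mathit{po}_{\rm loc}\cap(\mathit{fr}_{\rm e};\mathit{rf}_{\rm e})$, $\mathit{detour}=\mathit{po}_{\rm loc}\cap(\mathit{co}_{\rm e};\mathit{rf}_{\rm e})$, $\mathit{ii},\mathit{ic},\mathit{ci},\mathit{cc}$ are the least relations satisfying $\mathit{ii}=\mathit{dp}\cup\mathit{rdw}\cup\mathit{rf}_{\rm i}\cup\mathit{ci}\cup(\mathit{ic};\mathit{ci})\cup(\mathit{ii};\mathit{ii})$,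 $\mathit{ic}=\mathit{ii}\cup\mathit{cc}\cup(\mathit{ic};\mathit{cc})\cup(\mathit{ii};\mathit{ic})$, $\mathit{ci}=(\mathit{ctrl}\cap\mathit{isync}\text{ part of }\mathit{ctrl}\text{ followed by an isync})\cup\mathit{detour}\cup(\mathit{ci};\mathit{ii})\cup(\mathit{cc};\mathit{ci})$, $\mathit{cc}=\mathit{dp}\cup\mathit{po}_{\rm loc}\cup\mathit{ctrl}\cup(\mathit{addr};\mathit{po})\cup\mathit{ci}\cup(\mathit{ci};\mathit{ic})\cup(\mathit{cc};\mathit{cc})$. Here the first component of $\mathit{ci}$ is $\{(e,e')\}$ such that some isync fence event $f$ has $(e,f)\in\mathit{ctrl}$ and $(f,e')\in\mathit{po}$. Further: - $\mathit{fence}=\mathit{sync}\cup\mathit{tfence}\cup(\mathit{lwsync}\setminus(W\times R))$, $\ \mathit{ihb}=\mathit{ppo}\cup\mathit{fence}$ - $\mathit{thb}=(\mathit{rf}_{\rm e}\cup((\mathit{fr}_{\rm e}\cup\mathit{co}_{\rm e})^*;\mathit{ihb}))^*;(\mathit{fr}_{\rm e}\cup\mathit{co}_{\rm e})^*;\mathit{rf}_{\rm e}^?$ - $\mathit{hb}=(\mathit{rf}_{\rm e}^?;\mathit{ihb};\mathit{rf}_{\rm e}^?)\cup\mathsf{weaklift}(\mathit{thb},\mathit{stxn})$ - $\mathit{efence}=\mathit{rf}_{\rm e}^?;\mathit{fence};\mathit{rf}_{\rm e}^?$, $\ \mathit{prop}_1=[W];\mathit{efence};\mathit{hb}^*;[W]$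 - $\mathit{prop}_2=\mathit{com}_{\rm e}^*;\mathit{efence}^*;\mathit{hb}^*;(\mathit{sync}\cup\mathit{tfence});\mathit{hb}^*$ - $\mathit{prop}=\mathit{prop}_1\cup\mathit{prop}_2\cup(\mathit{rf}_{\rm e};\mathit{stxn};[W])\cup(\mathit{stxn};\mathit{rf}_{\rm e})$ Consistent iff: $\mathit{po}_{\rm loc}\cup\mathit{com}$ acyclic; $\mathit{rmw}\cap(\mathit{fr}_{\rm e};\mathit{co}_{\rm e})=\emptyset$; $\mathit{hb}$ acyclic; $\mathit{co}\cup\mathit{prop}$ acyclic; $\mathit{fr}_{\rm e};\mathit{prop};\mathit{hb}^*$ irreflexive; $\mathsf{stronglift}(\mathit{com},\mathit{stxn})$ acyclic; $\mathsf{stronglift}(\mathit{hb},\mathit{stxn})$ acyclic; $\mathit{rmw}\cap\mathit{tfence}^*=\emptyset$. **Transactional ARMv8.** Executions also have $\mathit{Acq}\subseteq R$, $\mathit{Rel}\subseteq W$ and a set $\mathit{ISB}\subseteq F$. With - $\mathit{dob}=\mathit{addr}\cup\mathit{data}\cup(\mathit{ctrl};[W])\cup((\mathit{ctrl}\cup(\mathit{addr};\mathit{po}));[\mathit{ISB}];\mathit{po};[R])\cup(\mathit{addr};\mathit{po};[W])\cup((\mathit{ctrl}\cup\mathit{data});\mathit{co}_{\rm i})\cup((\mathit{addr}\cup\mathit{data});\mathit{rf}_{\rm i})$ - $\mathit{aob}=\mathit{rmw}\cup([\mathrm{range}(\mathit{rmw})];\mathit{rf}_{\rm i};[\mathit{Acq}])$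 - $\mathit{bob}=\mathit{dmb}\cup([\mathit{Rel}];\mathit{po};[\mathit{Acq}])\cup([R];\mathit{dmbld})\cup([\mathit{Acq}];\mathit{po})\cup([W];\mathit{dmbst};[W])\cup(\mathit{po};[\mathit{Rel}])\cup(\mathit{po};[\mathit{Rel}];\mathit{co}_{\rm i})$ - $\mathit{ob}=\mathit{com}_{\rm e}\cup\mathit{dob}\cup\mathit{aob}\cup\mathit{bob}\cup\mathit{tfence}$ consistent iff: $\mathit{po}_{\rm loc}\cup\mathit{com}$ acyclic; $\mathit{ob}$ acyclic; $\mathit{rmw}\cap(\mathit{fr}_{\rm e};\mathit{co}_{\rm e})=\emptyset$; $\mathsf{stronglift}(\mathit{com},\mathit{stxn})$ acyclic; $\mathsf{stronglift}(\mathit{ob},\mathit{stxn})$ acyclic; $\mathit{rmw}\cap\mathit{tfence}^*=\emptyset$. *)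

theory Defs
  imports Main
begin

section \<open>Executions\<close>

record 'e execution =
  events :: "'e set"
  reads :: "'e set"
  writes :: "'e set"
  fences :: "'e set"
  po :: "'e rel"
  addr :: "'e rel"
  ctrl :: "'e rel"
  data :: "'e rel"
  sloc :: "'e rel"
  rmw :: "'e rel"
  rf :: "'e rel"
  co :: "'e rel"
  stxn :: "'e rel"

text \<open>
  The library closures \<open>r\<^sup>*\<close> and \<open>r\<^sup>=\<close> are reflexive on the whole event type, not just on
  \<open>events X\<close>. In a well-formed execution the extra identity pairs have no effect on the axioms
  below: such a closure is always composed with, intersected with, or subtracted from a relation
  on \<open>events X\<close>.
\<close>

definition same_thread :: "('e, 'm) execution_scheme \<Rightarrow> 'e rel" where
  "same_thread X = (po X \<union> (po X)\<inverse>)\<^sup>*"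

definition extl :: "('e, 'm) execution_scheme \<Rightarrow> 'e rel \<Rightarrow> 'e rel" where
  "extl X r = r - same_thread X"

definition intl :: "('e, 'm) execution_scheme \<Rightarrow> 'e rel \<Rightarrow> 'e rel" where
  "intl X r = r \<inter> same_thread X"

definition locl :: "('e, 'm) execution_scheme \<Rightarrow> 'e rel \<Rightarrow> 'e rel" where
  "locl X r = r \<inter> sloc X"

definition weaklift :: "'e rel \<Rightarrow> 'e rel \<Rightarrow> 'e rel" where
  "weaklift r t = t O (r - t) O t"

definition stronglift :: "'e rel \<Rightarrow> 'e rel \<Rightarrow> 'e rel" where
  "stronglift r t = t\<^sup>= O (r - t) O t\<^sup>="

text \<open>
  In \<open>wf_stxn\<close>, a class of \<open>stxn\<close> is contiguous in \<open>po\<close> if it lies in one thread and is convex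
  with respect to that thread's program order.
\<close>

definition wf_po :: "('e, 'm) execution_scheme \<Rightarrow> bool" where
  "wf_po X \<longleftrightarrow> po X \<subseteq> events X \<times> events X \<and> irrefl (po X) \<and> trans (po X) \<and>
     (\<forall>(a, b) \<in> same_thread X. a \<noteq> b \<longrightarrow> (a, b) \<in> po X \<or> (b, a) \<in> po X)"

definition wf_co :: "('e, 'm) execution_scheme \<Rightarrow> bool" where
  "wf_co X \<longleftrightarrow> co X \<subseteq> sloc X \<inter> (writes X \<times> writes X) \<and> irrefl (co X) \<and> trans (co X) \<and>
     (\<forall>(a, b) \<in> sloc X \<inter> (writes X \<times> writes X). a \<noteq> b \<longrightarrow> (a, b) \<in> co X \<or> (b, a) \<in> co X)"

definition wf_stxn :: "('e, 'm) execution_scheme \<Rightarrow> bool" where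
  "wf_stxn X \<longleftrightarrow> stxn X \<subseteq> events X \<times> events X \<and> sym (stxn X) \<and> trans (stxn X) \<and>
     stxn X \<subseteq> same_thread X \<and>
     (\<forall>a b c. (a, c) \<in> stxn X \<and> (a, b) \<in> po X \<and> (b, c) \<in> po X \<longrightarrow> (a, b) \<in> stxn X)"

definition wf_execution :: "('e, 'm) execution_scheme \<Rightarrow> bool" where
  "wf_execution X \<longleftrightarrow>
     finite (events X) \<and>
     events X = reads X \<union> writes X \<union> fences X \<and>
     reads X \<inter> writes X = {} \<and> reads X \<inter> fences X = {} \<and> writes X \<inter> fences X = {} \<and>
     wf_po X \<and>
     addr X \<subseteq> po X \<and> ctrl X \<subseteq> po X \<and> data X \<subseteq> po X \<and>
     Domain (addr X \<union> ctrl X \<union> data X) \<subseteq> reads X \<and>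
     equiv (reads X \<union> writes X) (sloc X) \<and>
     rmw X \<subseteq> locl X (po X) \<inter> (reads X \<times> writes X) \<and>
     rf X \<subseteq> sloc X \<inter> (writes X \<times> reads X) \<and> single_valued ((rf X)\<inverse>) \<and>
     wf_co X \<and> wf_stxn X"

definition fr :: "('e, 'm) execution_scheme \<Rightarrow> 'e rel" where
  "fr X = (Id_on (reads X) O sloc X O Id_on (writes X)) - ((rf X)\<inverse> O ((co X)\<inverse>)\<^sup>*)"

definition com :: "('e, 'm) execution_scheme \<Rightarrow> 'e rel" where
  "com X = rf X \<union> co X \<union> fr X"

definition not_stxn :: "('e, 'm) execution_scheme \<Rightarrow> 'e rel" where
  "not_stxn X = events X \<times> events X - stxn X"

definition tfence :: "('e, 'm) execution_scheme \<Rightarrow> 'e rel" where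
  "tfence X = po X \<inter> ((not_stxn X O stxn X) \<union> (stxn X O not_stxn X))"

definition fence_rel :: "('e, 'm) execution_scheme \<Rightarrow> 'e set \<Rightarrow> 'e rel" where
  "fence_rel X K = po X O Id_on K O po X"

section \<open>Transactional Power\<close>

record 'e power_execution = "'e execution" +
  sync_fences :: "'e set"
  lwsync_fences :: "'e set"
  isync_fences :: "'e set"

definition wf_power :: "'e power_execution \<Rightarrow> bool" where
  "wf_power X \<longleftrightarrow> wf_execution X \<and>
     sync_fences X \<subseteq> fences X \<and> lwsync_fences X \<subseteq> fences X \<and> isync_fences X \<subseteq> fences X"

definition sync :: "'e power_execution \<Rightarrow> 'e rel" where
  "sync X = fence_rel X (sync_fences X)"

definition lwsync :: "'e power_execution \<Rightarrow> 'e rel" where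
  "lwsync X = fence_rel X (lwsync_fences X)"

definition ctrl_isync :: "'e power_execution \<Rightarrow> 'e rel" where
  "ctrl_isync X = ctrl X O Id_on (isync_fences X) O po X"

definition dp :: "'e power_execution \<Rightarrow> 'e rel" where
  "dp X = addr X \<union> data X"

definition rdw :: "'e power_execution \<Rightarrow> 'e rel" where
  "rdw X = locl X (po X) \<inter> (extl X (fr X) O extl X (rf X))"

definition detour :: "'e power_execution \<Rightarrow> 'e rel" where
  "detour X = locl X (po X) \<inter> (extl X (co X) O extl X (rf X))"

inductive_set ii :: "'e power_execution \<Rightarrow> 'e rel"
  and ic :: "'e power_execution \<Rightarrow> 'e rel"
  and ci :: "'e power_execution \<Rightarrow> 'e rel"
  and cc :: "'e power_execution \<Rightarrow> 'e rel"
  for X :: "'e power_execution"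
where
  ii_dp: "p \<in> dp X \<Longrightarrow> p \<in> ii X"
| ii_rdw: "p \<in> rdw X \<Longrightarrow> p \<in> ii X"
| ii_rfi: "p \<in> intl X (rf X) \<Longrightarrow> p \<in> ii X"
| ii_ci: "p \<in> ci X \<Longrightarrow> p \<in> ii X"
| ii_ic_ci: "(a, b) \<in> ic X \<Longrightarrow> (b, c) \<in> ci X \<Longrightarrow> (a, c) \<in> ii X"
| ii_ii_ii: "(a, b) \<in> ii X \<Longrightarrow> (b, c) \<in> ii X \<Longrightarrow> (a, c) \<in> ii X"
| ic_ii: "p \<in> ii X \<Longrightarrow> p \<in> ic X"
| ic_cc: "p \<in> cc X \<Longrightarrow> p \<in> ic X"
| ic_ic_cc: "(a, b) \<in> ic X \<Longrightarrow> (b, c) \<in> cc X \<Longrightarrow> (a, c) \<in> ic X"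
| ic_ii_ic: "(a, b) \<in> ii X \<Longrightarrow> (b, c) \<in> ic X \<Longrightarrow> (a, c) \<in> ic X"
| ci_ctrl_isync: "p \<in> ctrl_isync X \<Longrightarrow> p \<in> ci X"
| ci_detour: "p \<in> detour X \<Longrightarrow> p \<in> ci X"
| ci_ci_ii: "(a, b) \<in> ci X \<Longrightarrow> (b, c) \<in> ii X \<Longrightarrow> (a, c) \<in> ci X"
| ci_cc_ci: "(a, b) \<in> cc X \<Longrightarrow> (b, c) \<in> ci X \<Longrightarrow> (a, c) \<in> ci X"
| cc_dp: "p \<in> dp X \<Longrightarrow> p \<in> cc X"
| cc_poloc: "p \<in> locl X (po X) \<Longrightarrow> p \<in> cc X"
| cc_ctrl: "p \<in> ctrl X \<Longrightarrow> p \<in> cc X"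
| cc_addr_po: "p \<in> addr X O po X \<Longrightarrow> p \<in> cc X"
| cc_ci: "p \<in> ci X \<Longrightarrow> p \<in> cc X"
| cc_ci_ic: "(a, b) \<in> ci X \<Longrightarrow> (b, c) \<in> ic X \<Longrightarrow> (a, c) \<in> cc X"
| cc_cc_cc: "(a, b) \<in> cc X \<Longrightarrow> (b, c) \<in> cc X \<Longrightarrow> (a, c) \<in> cc X"

definition ppo :: "'e power_execution \<Rightarrow> 'e rel" where
  "ppo X = (Id_on (reads X) O ii X O Id_on (reads X)) \<union> (Id_on (reads X) O ic X O Id_on (writes X))"

definition fence :: "'e power_execution \<Rightarrow> 'e rel" where
  "fence X = sync X \<union> tfence X \<union> (lwsync X - writes X \<times> reads X)"

definition ihb :: "'e power_execution \<Rightarrow> 'e rel" where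
  "ihb X = ppo X \<union> fence X"

definition thb :: "'e power_execution \<Rightarrow> 'e rel" where
  "thb X = (extl X (rf X) \<union> ((extl X (fr X) \<union> extl X (co X))\<^sup>* O ihb X))\<^sup>* O
     (extl X (fr X) \<union> extl X (co X))\<^sup>* O (extl X (rf X))\<^sup>="

definition hb :: "'e power_execution \<Rightarrow> 'e rel" where
  "hb X = ((extl X (rf X))\<^sup>= O ihb X O (extl X (rf X))\<^sup>=) \<union> weaklift (thb X) (stxn X)"

definition efence :: "'e power_execution \<Rightarrow> 'e rel" where
  "efence X = (extl X (rf X))\<^sup>= O fence X O (extl X (rf X))\<^sup>="

definition prop1 :: "'e power_execution \<Rightarrow> 'e rel" where
  "prop1 X = Id_on (writes X) O efence X O (hb X)\<^sup>* O Id_on (writes X)"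

definition prop2 :: "'e power_execution \<Rightarrow> 'e rel" where
  "prop2 X = (extl X (com X))\<^sup>* O (efence X)\<^sup>* O (hb X)\<^sup>* O (sync X \<union> tfence X) O (hb X)\<^sup>*"

definition power_prop :: "'e power_execution \<Rightarrow> 'e rel" where
  "power_prop X = prop1 X \<union> prop2 X \<union> (extl X (rf X) O stxn X O Id_on (writes X)) \<union>
     (stxn X O extl X (rf X))"

definition power_consistent :: "'e power_execution \<Rightarrow> bool" where
  "power_consistent X \<longleftrightarrow>
     acyclic (locl X (po X) \<union> com X) \<and>
     rmw X \<inter> (extl X (fr X) O extl X (co X)) = {} \<and>
     acyclic (hb X) \<and>
     acyclic (co X \<union> power_prop X) \<and>
     irrefl (extl X (fr X) O power_prop X O (hb X)\<^sup>*) \<and>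
     acyclic (stronglift (com X) (stxn X)) \<and>
     acyclic (stronglift (hb X) (stxn X)) \<and>
     rmw X \<inter> (tfence X)\<^sup>* = {}"

section \<open>Transactional ARMv8\<close>

record 'e arm_execution = "'e execution" +
  acquires :: "'e set"
  releases :: "'e set"
  isb_fences :: "'e set"
  dmb_fences :: "'e set"
  dmbld_fences :: "'e set"
  dmbst_fences :: "'e set"

definition wf_arm :: "'e arm_execution \<Rightarrow> bool" where
  "wf_arm X \<longleftrightarrow> wf_execution X \<and>
     acquires X \<subseteq> reads X \<and> releases X \<subseteq> writes X \<and>
     isb_fences X \<subseteq> fences X \<and> dmb_fences X \<subseteq> fences X \<and>
     dmbld_fences X \<subseteq> fences X \<and> dmbst_fences X \<subseteq> fences X"

definition dmb :: "'e arm_execution \<Rightarrow> 'e rel" where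
  "dmb X = fence_rel X (dmb_fences X)"

definition dmbld :: "'e arm_execution \<Rightarrow> 'e rel" where
  "dmbld X = fence_rel X (dmbld_fences X)"

definition dmbst :: "'e arm_execution \<Rightarrow> 'e rel" where
  "dmbst X = fence_rel X (dmbst_fences X)"

definition dob :: "'e arm_execution \<Rightarrow> 'e rel" where
  "dob X = addr X \<union> data X \<union>
     (ctrl X O Id_on (writes X)) \<union>
     ((ctrl X \<union> (addr X O po X)) O Id_on (isb_fences X) O po X O Id_on (reads X)) \<union>
     (addr X O po X O Id_on (writes X)) \<union>
     ((ctrl X \<union> data X) O intl X (co X)) \<union>
     ((addr X \<union> data X) O intl X (rf X))"

definition aob :: "'e arm_execution \<Rightarrow> 'e rel" where
  "aob X = rmw X \<union> (Id_on (Range (rmw X)) O intl X (rf X) O Id_on (acquires X))"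

definition bob :: "'e arm_execution \<Rightarrow> 'e rel" where
  "bob X = dmb X \<union>
     (Id_on (releases X) O po X O Id_on (acquires X)) \<union>
     (Id_on (reads X) O dmbld X) \<union>
     (Id_on (acquires X) O po X) \<union>
     (Id_on (writes X) O dmbst X O Id_on (writes X)) \<union>
     (po X O Id_on (releases X)) \<union>
     (po X O Id_on (releases X) O intl X (co X))"

definition ob :: "'e arm_execution \<Rightarrow> 'e rel" where
  "ob X = extl X (com X) \<union> dob X \<union> aob X \<union> bob X \<union> tfence X"

definition arm_consistent :: "'e arm_execution \<Rightarrow> bool" where
  "arm_consistent X \<longleftrightarrow>
     acyclic (locl X (po X) \<union> com X) \<and>
     acyclic (ob X) \<and>
     rmw X \<inter> (extl X (fr X) O extl X (co X)) = {} \<and>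
     acyclic (stronglift (com X) (stxn X)) \<and>
     acyclic (stronglift (ob X) (stxn X)) \<and>
     rmw X \<inter> (tfence X)\<^sup>* = {}"

section \<open>Monotonicity and coalescing\<close>

text \<open>
  A model is given by its well-formedness predicate \<open>valid\<close> and its consistency predicate \<open>consistent\<close>.
\<close>

definition txn_monotone ::
  "(('e, 'm) execution_scheme \<Rightarrow> bool) \<Rightarrow> (('e, 'm) execution_scheme \<Rightarrow> bool) \<Rightarrow> bool" where
  "txn_monotone valid consistent \<longleftrightarrow>
     (\<forall>X t. valid X \<and> valid (X\<lparr>stxn := t\<rparr>) \<and> stxn X \<subseteq> t \<and> consistent (X\<lparr>stxn := t\<rparr>) \<longrightarrow> consistent X)"

text \<open>
  Coalescing merges two distinct transactions \<open>A\<close> and \<open>B\<close> into one. That they are consecutive in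
  program order is enforced by well-formedness of the result: \<open>A \<union> B\<close> must be contiguous.
\<close>

definition coalescing_sound ::
  "(('e, 'm) execution_scheme \<Rightarrow> bool) \<Rightarrow> (('e, 'm) execution_scheme \<Rightarrow> bool) \<Rightarrow> bool" where
  "coalescing_sound valid consistent \<longleftrightarrow>
     (\<forall>X Y A B. valid X \<and> valid Y \<and>
        A \<in> Field (stxn X) // stxn X \<and> B \<in> Field (stxn X) // stxn X \<and> A \<noteq> B \<and>
        Y = X\<lparr>stxn := stxn X \<union> (A \<union> B) \<times> (A \<union> B)\<rparr> \<and> consistent Y \<longrightarrow> consistent X)"

section \<open>A read-modify-write split over two singleton transactions\<close>

definition split_rmw_power :: "'e \<Rightarrow> 'e \<Rightarrow> 'e power_execution" where
  "split_rmw_power r w = \<lparr>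
     events = {r, w}, reads = {r}, writes = {w}, fences = {},
     po = {(r, w)}, addr = {}, ctrl = {}, data = {},
     sloc = {r, w} \<times> {r, w}, rmw = {(r, w)}, rf = {}, co = {},
     stxn = {(r, r), (w, w)},
     sync_fences = {}, lwsync_fences = {}, isync_fences = {}\<rparr>"

definition split_rmw_arm :: "'e \<Rightarrow> 'e \<Rightarrow> 'e arm_execution" where
  "split_rmw_arm r w = \<lparr>
     events = {r, w}, reads = {r}, writes = {w}, fences = {},
     po = {(r, w)}, addr = {}, ctrl = {}, data = {},
     sloc = {r, w} \<times> {r, w}, rmw = {(r, w)}, rf = {}, co = {},
     stxn = {(r, r), (w, w)},
     acquires = {}, releases = {},
     isb_fences = {}, dmb_fences = {}, dmbld_fences = {}, dmbst_fences = {}\<rparr>"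

end

(*
  With two singleton transactions the program-order edge (r, w) crosses a transaction boundary, so it
  is both an rmw and a tfence edge, which is forbidden. Once {r, w} is a single transaction, tfence is
  empty, and everything else is harmless: there is a single thread, so all external relations vanish,
  and the remaining relations only relate r to w.
*)

theory Submission
  imports Defs
begin

text \<open>Coalescing only enlarges \<open>stxn\<close>, so it is an instance of monotonicity. Read
  contrapositively, a coalescing counterexample also refutes monotonicity.\<close>

lemma txn_monotone_imp_coalescing_sound:
  assumes "txn_monotone valid consistent"
  shows "coalescing_sound valid consistent"
  unfolding coalescing_sound_def
proof (intro allI impI, elim conjE)
  fix X Y A B
  assume "valid X" "valid Y" "consistent Y"
    and Y: "Y = X\<lparr>stxn := stxn X \<union> (A \<union> B) \<times> (A \<union> B)\<rparr>"
  moreover have "stxn X \<subseteq> stxn X \<union> (A \<union> B) \<times> (A \<union> B)"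
    by simp
  ultimately show "consistent X"
    using assms unfolding txn_monotone_def by metis
qed

lemma acyclic_subset_pair:
  assumes "a \<noteq> b" "s \<subseteq> {(a, b)}"
  shows "acyclic s"
proof (rule acyclic_subset)
  show "acyclic {(a, b)}"
    using assms by (simp add: wf_acyclic)
qed (rule assms)

text \<open>\<open>stxn\<close> and the record extension stay open, so the same facts serve the
  split and the merged execution in both models.\<close>

locale rmw_pair =
  fixes r w :: 'e and X :: "('e, 'm) execution_scheme"
  assumes distinct: "r \<noteq> w"
    and components: "events X = {r, w}" "reads X = {r}" "writes X = {w}" "fences X = {}"
      "po X = {(r, w)}" "addr X = {}" "ctrl X = {}" "data X = {}"
      "sloc X = {r, w} \<times> {r, w}" "rmw X = {(r, w)}" "rf X = {}" "co X = {}"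
begin

lemma same_thread_eq: "same_thread X = Id \<union> {r, w} \<times> {r, w}"
proof -
  have "(a, b) \<in> Id \<union> {r, w} \<times> {r, w}" if "(a, b) \<in> {(w, r), (r, w)}\<^sup>*" for a b
    using that by (induction rule: rtrancl_induct) auto
  moreover have "Id \<union> {r, w} \<times> {r, w} \<subseteq> {(w, r), (r, w)}\<^sup>*"
    by auto
  ultimately have "{(w, r), (r, w)}\<^sup>* = Id \<union> {r, w} \<times> {r, w}"
    by (meson subrelI subset_antisym)
  moreover have "po X \<union> (po X)\<inverse> = {(w, r), (r, w)}"
    by (auto simp: components)
  ultimately show ?thesis
    by (simp only: same_thread_def)
qed

lemma extl_empty: "s \<subseteq> {(r, w)} \<Longrightarrow> extl X s = {}"
  by (auto simp: extl_def same_thread_eq)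

lemma intl_empty: "intl X {} = {}"
  by (simp add: intl_def)

text \<open>Stated for the literal edge because \<open>components\<close> has already rewritten
  \<open>po X\<close> when this is used for simplification.\<close>

lemma locl_po: "locl X {(r, w)} = {(r, w)}"
  by (auto simp: locl_def components)

text \<open>Since \<open>rf X\<close> is empty, nothing is subtracted in \<open>fr\<close>:
  \<open>r\<close> reads the initial value and therefore precedes the only write.\<close>

lemma fr_eq: "fr X = {(r, w)}"
  by (auto simp: fr_def components)

lemma com_eq: "com X = {(r, w)}"
  by (simp add: com_def components fr_eq)

lemmas relation_simps =
  components locl_po fr_eq com_eq extl_empty intl_empty

lemma wf_execution_iff: "wf_execution X \<longleftrightarrow> wf_stxn X"
proof -
  have "wf_po X"
    using distinct by (auto simp: wf_po_def components same_thread_eq irrefl_def trans_def)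
  moreover have "wf_co X"
    by (auto simp: wf_co_def components irrefl_def trans_def)
  moreover have "equiv (reads X \<union> writes X) (sloc X)"
    by (auto simp: components intro!: equivI refl_onI symI transI)
  ultimately show ?thesis
    using distinct by (auto simp: wf_execution_def relation_simps single_valued_def)
qed

lemma wf_execution_split: "stxn X = {(r, r), (w, w)} \<Longrightarrow> wf_execution X"
  using distinct
  by (auto simp: wf_execution_iff wf_stxn_def components same_thread_eq intro!: symI transI)

lemma wf_execution_merged: "stxn X = {r, w} \<times> {r, w} \<Longrightarrow> wf_execution X"
  by (auto simp: wf_execution_iff wf_stxn_def components same_thread_eq intro!: symI transI)

text \<open>The edge factors as \<open>(r, w)\<close> in \<open>not_stxn X\<close> followed by the
  loop \<open>(w, w)\<close> in \<open>stxn X\<close>.\<close>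

lemma tfence_split:
  assumes "stxn X = {(r, r), (w, w)}"
  shows "tfence X = {(r, w)}"
  using distinct by (auto simp: tfence_def not_stxn_def components assms)

lemma rmw_tfence_split: "stxn X = {(r, r), (w, w)} \<Longrightarrow> rmw X \<inter> (tfence X)\<^sup>* \<noteq> {}"
  by (auto simp: tfence_split components)

lemma tfence_merged: "stxn X = {r, w} \<times> {r, w} \<Longrightarrow> tfence X = {}"
  by (auto simp: tfence_def not_stxn_def components)

text \<open>Lifting first removes the edges inside a transaction, and here that removes every edge
  of \<open>s\<close>.\<close>

lemma stronglift_merged:
  "stxn X = {r, w} \<times> {r, w} \<Longrightarrow> s \<subseteq> {(r, w)} \<Longrightarrow> stronglift s (stxn X) = {}"
  by (auto simp: stronglift_def)

end

locale power_rmw_pair = rmw_pair r w X for r w :: 'e and X :: "'e power_execution" +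
  assumes power_components: "sync_fences X = {}" "lwsync_fences X = {}" "isync_fences X = {}"
begin

text \<open>By mutual induction: among the base relations only same-location program order is
  inhabited, and the composition rules never apply because \<open>(r, w)\<close> does not compose
  with itself when \<open>r\<close> and \<open>w\<close> differ.\<close>

lemma ii_ic_ci_cc_subset:
  "p \<in> ii X \<Longrightarrow> p = (r, w)"
  "p \<in> ic X \<Longrightarrow> p = (r, w)"
  "p \<in> ci X \<Longrightarrow> p = (r, w)"
  "p \<in> cc X \<Longrightarrow> p = (r, w)"
  using distinct
  by (induction rule: ii_ic_ci_cc.inducts)
    (auto simp: dp_def rdw_def detour_def ctrl_isync_def relation_simps)

lemma ppo_subset: "ppo X \<subseteq> {(r, w)}"
  by (auto simp: ppo_def dest: ii_ic_ci_cc_subset)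

lemma fence_merged: "stxn X = {r, w} \<times> {r, w} \<Longrightarrow> fence X = {}"
  by (simp add: fence_def sync_def lwsync_def fence_rel_def power_components tfence_merged)

lemma hb_merged:
  assumes "stxn X = {r, w} \<times> {r, w}"
  shows "hb X \<subseteq> {(r, w)}"
proof -
  have ihb: "ihb X \<subseteq> {(r, w)}"
    using ppo_subset by (simp add: ihb_def fence_merged assms)
  have "(ihb X)\<^sup>* \<subseteq> Id \<union> {(r, w)}"
  proof (rule subrelI)
    fix a b assume "(a, b) \<in> (ihb X)\<^sup>*"
    then show "(a, b) \<in> Id \<union> {(r, w)}"
      using ihb distinct by (induction rule: rtrancl_induct) auto
  qed
  \<comment> \<open>Without external edges \<open>thb\<close> collapses to the reflexive-transitive
    closure of \<open>ihb\<close>. Its identity pairs range over the whole type, but composing with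
    \<open>stxn\<close> on both sides confines them to \<open>{r, w}\<close>, where
    \<open>stxn\<close> is total and the difference is empty.\<close>
  then have "weaklift (thb X) (stxn X) = {}"
    by (auto simp: weaklift_def thb_def relation_simps assms)
  then show ?thesis
    using ihb by (simp add: hb_def relation_simps)
qed

lemma not_power_consistent_split: "stxn X = {(r, r), (w, w)} \<Longrightarrow> \<not> power_consistent X"
  using rmw_tfence_split by (simp add: power_consistent_def)

lemma power_consistent_merged:
  assumes "stxn X = {r, w} \<times> {r, w}"
  shows "power_consistent X"
proof -
  have "efence X = {}"
    by (simp add: efence_def fence_merged assms)
  moreover have "sync X = {}"
    by (simp add: sync_def fence_rel_def power_components)
  \<comment> \<open>Each summand has an empty factor: \<open>efence\<close> in \<open>prop1\<close>,
    \<open>sync\<close> and \<open>tfence\<close> in \<open>prop2\<close>, and external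
    \<open>rf\<close> in the other two.\<close>
  ultimately have "power_prop X = {}"
    by (simp add: power_prop_def prop1_def prop2_def relation_simps tfence_merged assms)
  \<comment> \<open>The closure of the empty \<open>tfence\<close> is \<open>Id\<close>, so the last
    axiom reduces to \<open>r\<close> and \<open>w\<close> being distinct.\<close>
  then show ?thesis
    using distinct hb_merged[OF assms]
    by (simp add: power_consistent_def relation_simps tfence_merged[OF assms]
        stronglift_merged[OF assms] acyclic_subset_pair irrefl_def)
qed

lemma wf_power_iff: "wf_power X \<longleftrightarrow> wf_execution X"
  by (simp add: wf_power_def power_components)

end

locale arm_rmw_pair = rmw_pair r w X for r w :: 'e and X :: "'e arm_execution" +
  assumes arm_components: "acquires X = {}" "releases X = {}" "isb_fences X = {}"
    "dmb_fences X = {}" "dmbld_fences X = {}" "dmbst_fences X = {}"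
begin

text \<open>The surviving edge is \<open>rmw\<close>, contributed by \<open>aob\<close>.\<close>

lemma ob_merged:
  assumes "stxn X = {r, w} \<times> {r, w}"
  shows "ob X = {(r, w)}"
  by (simp add: ob_def dob_def aob_def bob_def dmb_def dmbld_def dmbst_def fence_rel_def
      arm_components relation_simps tfence_merged[OF assms])

lemma not_arm_consistent_split: "stxn X = {(r, r), (w, w)} \<Longrightarrow> \<not> arm_consistent X"
  using rmw_tfence_split by (simp add: arm_consistent_def)

lemma arm_consistent_merged:
  assumes "stxn X = {r, w} \<times> {r, w}"
  shows "arm_consistent X"
  using distinct
  by (simp add: arm_consistent_def relation_simps tfence_merged[OF assms] ob_merged[OF assms]
      stronglift_merged[OF assms] acyclic_subset_pair)

lemma wf_arm_iff: "wf_arm X \<longleftrightarrow> wf_execution X"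
  by (simp add: wf_arm_def arm_components)

end

lemma not_coalescing_sound_split_merged:
  assumes "stxn X = {(r, r), (w, w)}" "r \<noteq> w"
    and "valid X" "\<not> consistent X"
    and "valid (X\<lparr>stxn := {r, w} \<times> {r, w}\<rparr>)" "consistent (X\<lparr>stxn := {r, w} \<times> {r, w}\<rparr>)"
  shows "\<not> coalescing_sound valid consistent"
proof
  \<comment> \<open>The shape \<open>{r} \<union> {w}\<close> matches the definition of coalescing,
    with the singleton classes as \<open>A\<close> and \<open>B\<close>.\<close>
  let ?Y = "X\<lparr>stxn := stxn X \<union> ({r} \<union> {w}) \<times> ({r} \<union> {w})\<rparr>"
  assume sound: "coalescing_sound valid consistent"
  have "stxn X \<union> ({r} \<union> {w}) \<times> ({r} \<union> {w}) = {r, w} \<times> {r, w}"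
    using assms(1) by auto
  then have "valid ?Y" "consistent ?Y"
    using assms by simp_all
  moreover have "{r} \<in> Field (stxn X) // stxn X" "{w} \<in> Field (stxn X) // stxn X"
    using assms by (auto simp: quotient_def Field_def)
  moreover have "{r} \<noteq> {w}"
    using assms by simp
  ultimately show False
    using sound assms unfolding coalescing_sound_def by blast
qed

theorem mainTheorem4:
  fixes r w :: 'e
  assumes "r \<noteq> w"
  shows
    "(let X = split_rmw_power r w; Y = X\<lparr>stxn := {r, w} \<times> {r, w}\<rparr> in
        wf_power X \<and> wf_power Y \<and> \<not> power_consistent X \<and> power_consistent Y) \<and>
     (let X = split_rmw_arm r w; Y = X\<lparr>stxn := {r, w} \<times> {r, w}\<rparr> in
        wf_arm X \<and> wf_arm Y \<and> \<not> arm_consistent X \<and> arm_consistent Y) \<and>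
     \<not> txn_monotone (wf_power :: 'e power_execution \<Rightarrow> bool) power_consistent \<and>
     \<not> txn_monotone (wf_arm :: 'e arm_execution \<Rightarrow> bool) arm_consistent \<and>
     \<not> coalescing_sound (wf_power :: 'e power_execution \<Rightarrow> bool) power_consistent \<and>
     \<not> coalescing_sound (wf_arm :: 'e arm_execution \<Rightarrow> bool) arm_consistent"
proof -
  let ?P = "split_rmw_power r w" and ?A = "split_rmw_arm r w"
  let ?P' = "?P\<lparr>stxn := {r, w} \<times> {r, w}\<rparr>" and ?A' = "?A\<lparr>stxn := {r, w} \<times> {r, w}\<rparr>"
  interpret P: power_rmw_pair r w ?P
    using assms by unfold_locales (simp_all add: split_rmw_power_def)
  interpret P': power_rmw_pair r w ?P'
    using assms by unfold_locales (simp_all add: split_rmw_power_def)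
  interpret A: arm_rmw_pair r w ?A
    using assms by unfold_locales (simp_all add: split_rmw_arm_def)
  interpret A': arm_rmw_pair r w ?A'
    using assms by unfold_locales (simp_all add: split_rmw_arm_def)
  have stxn: "stxn ?P = {(r, r), (w, w)}" "stxn ?A = {(r, r), (w, w)}"
    by (simp_all add: split_rmw_power_def split_rmw_arm_def)
  have power: "wf_power ?P" "wf_power ?P'" "\<not> power_consistent ?P" "power_consistent ?P'"
    using P.wf_execution_split P'.wf_execution_merged P.wf_power_iff P'.wf_power_iff
      P.not_power_consistent_split P'.power_consistent_merged stxn
    by fastforce+
  have arm: "wf_arm ?A" "wf_arm ?A'" "\<not> arm_consistent ?A" "arm_consistent ?A'"
    using A.wf_execution_split A'.wf_execution_merged A.wf_arm_iff A'.wf_arm_iff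
      A.not_arm_consistent_split A'.arm_consistent_merged stxn
    by fastforce+
  have "\<not> coalescing_sound (wf_power :: 'e power_execution \<Rightarrow> bool) power_consistent"
    using not_coalescing_sound_split_merged[OF stxn(1) assms] power by blast
  moreover from this have "\<not> txn_monotone (wf_power :: 'e power_execution \<Rightarrow> bool) power_consistent"
    by (metis txn_monotone_imp_coalescing_sound)
  moreover have "\<not> coalescing_sound (wf_arm :: 'e arm_execution \<Rightarrow> bool) arm_consistent"
    using not_coalescing_sound_split_merged[OF stxn(2) assms] arm by blast
  moreover from this have "\<not> txn_monotone (wf_arm :: 'e arm_execution \<Rightarrow> bool) arm_consistent"
    by (metis txn_monotone_imp_coalescing_sound)
  ultimately show ?thesis
    using power arm unfolding Let_def by blast
qed

end
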